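(* Let $n=k^2$, where $k$ is an integer with $k\ge 2$. Consider the equation $$x^4+y^4+z^4-2x^2y^2-2y^2z^2-2z^2x^2=n ,$$ and let $S$ be the set of all rational solutions $(a,b,c)$ of this equation with exactly one of $a,b,c$ being zero. Then $S$ is an infinite set, and it is the union $S=C_1\cup C_2\cup C_3\cup C_4\cup C_5\cup C_6$ of six classes described parametrically as follows. Let $k_1,k_2$ range over the positive integers with $k_1k_2=k$, and let $m_1,m_2$ range over the relatively prime positive integers with $k_1m_1^2\ne k_2m_2^2$; put $$e=\frac12\left(\frac{k_1m_1}{m_2}+\frac{k_2m_2}{m_1}\right)>0,\qquad f=\frac12\left|\frac{k_1m_1}{m_2}-\frac{k_2m_2}{m_1}\right|>0 .$$ Then, over all such choices of parameters and with all sign combinations being possible, $C_1$ is the set of triples of the form $(\pm e,\pm f,0)$; $C_2$ is the set of triples of the form $(\pm e,0,\pm f)$; $C_3$ is the set of triples of the form $(\pm f,\pm e,0)$; $C_4$ is the set of triples of the form $(\pm f,0,\pm e)$; $C_5$ is the set of triples of the form $(0,\pm e,\pm f)$; $C_6$ is the set of triples of the form $(0,\pm f,\pm e)$. *)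

theory Defs
  imports Complex_Main
begin

definition quartic :: "rat \<Rightarrow> rat \<Rightarrow> rat \<Rightarrow> rat" where
  "quartic x y z =
     x^4 + y^4 + z^4 - 2 * x^2 * y^2 - 2 * y^2 * z^2 - 2 * z^2 * x^2"

definition exactly_one_zero :: "rat \<Rightarrow> rat \<Rightarrow> rat \<Rightarrow> bool" where
  "exactly_one_zero a b c \<longleftrightarrow>
     (a = 0 \<and> b \<noteq> 0 \<and> c \<noteq> 0) \<or>
     (a \<noteq> 0 \<and> b = 0 \<and> c \<noteq> 0) \<or>
     (a \<noteq> 0 \<and> b \<noteq> 0 \<and> c = 0)"

definition solutions :: "int \<Rightarrow> (rat \<times> rat \<times> rat) set" where
  "solutions n = {(a, b, c). quartic a b c = of_int n \<and> exactly_one_zero a b c}"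

definition admissible :: "int \<Rightarrow> int \<Rightarrow> int \<Rightarrow> int \<Rightarrow> int \<Rightarrow> bool" where
  "admissible k k1 k2 m1 m2 \<longleftrightarrow>
     k1 > 0 \<and> k2 > 0 \<and> k1 * k2 = k \<and>
     m1 > 0 \<and> m2 > 0 \<and> coprime m1 m2 \<and> k1 * m1^2 \<noteq> k2 * m2^2"

definition e_val :: "int \<Rightarrow> int \<Rightarrow> int \<Rightarrow> int \<Rightarrow> rat" where
  "e_val k1 k2 m1 m2 =
     1/2 * (of_int k1 * of_int m1 / of_int m2 + of_int k2 * of_int m2 / of_int m1)"

definition f_val :: "int \<Rightarrow> int \<Rightarrow> int \<Rightarrow> int \<Rightarrow> rat" where
  "f_val k1 k2 m1 m2 =
     1/2 * \<bar>of_int k1 * of_int m1 / of_int m2 - of_int k2 * of_int m2 / of_int m1\<bar>"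

definition signed_pairs :: "int \<Rightarrow> (rat \<times> rat) set" where
  "signed_pairs k =
     {(s * e_val k1 k2 m1 m2, t * f_val k1 k2 m1 m2) | s t k1 k2 m1 m2.
        s \<in> {1, -1} \<and> t \<in> {1, -1} \<and> admissible k k1 k2 m1 m2}"

definition C1 :: "int \<Rightarrow> (rat \<times> rat \<times> rat) set" where
  "C1 k = {(u, v, 0) | u v. (u, v) \<in> signed_pairs k}"

definition C2 :: "int \<Rightarrow> (rat \<times> rat \<times> rat) set" where
  "C2 k = {(u, 0, v) | u v. (u, v) \<in> signed_pairs k}"

definition C3 :: "int \<Rightarrow> (rat \<times> rat \<times> rat) set" where
  "C3 k = {(v, u, 0) | u v. (u, v) \<in> signed_pairs k}"

definition C4 :: "int \<Rightarrow> (rat \<times> rat \<times> rat) set" where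
  "C4 k = {(v, 0, u) | u v. (u, v) \<in> signed_pairs k}"

definition C5 :: "int \<Rightarrow> (rat \<times> rat \<times> rat) set" where
  "C5 k = {(0, u, v) | u v. (u, v) \<in> signed_pairs k}"

definition C6 :: "int \<Rightarrow> (rat \<times> rat \<times> rat) set" where
  "C6 k = {(0, v, u) | u v. (u, v) \<in> signed_pairs k}"

end

theory Submission
  imports Defs
begin

text \<open>
  When one variable vanishes the quartic becomes a perfect square: for \<open>z = 0\<close> it is
  \<open>(x\<^sup>2 - y\<^sup>2)\<^sup>2\<close>. Since \<open>n = k\<^sup>2\<close>, the equation then says
  \<open>x\<^sup>2 - y\<^sup>2 = k\<close> or \<open>y\<^sup>2 - x\<^sup>2 = k\<close>. The three choices of the vanishing variable and the
  two signs are the six classes, so everything reduces to the rational points of the one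
  hyperbola \<open>u\<^sup>2 - v\<^sup>2 = k\<close> off the axis \<open>v = 0\<close> (lemma \<open>signed_pairs_eq_hyperbola\<close>).

  On this hyperbola \<open>p = \<bar>u\<bar> + \<bar>v\<bar>\<close> is a positive rational with \<open>\<bar>u\<bar> - \<bar>v\<bar> = k / p\<close>, hence
  \<open>\<bar>u\<bar> = (p + k / p) / 2\<close> and \<open>\<bar>v\<bar> = (p - k / p) / 2\<close>. Writing \<open>p = m1 / m2\<close> in lowest terms
  gives the required parameters with \<open>k1 = 1\<close> and \<open>k2 = k\<close>, a factorisation that already
  reaches every point. Conversely, for any factorisation \<open>k = k1 * k2\<close> the numbers
  \<open>k1 * m1 / m2\<close> and \<open>k2 * m2 / m1\<close> have product \<open>k\<close>, so their half sum and half difference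
  lie on the hyperbola. Letting \<open>p\<close> run through the integers above \<open>k\<close> gives infinitely many
  solutions, because \<open>p\<close> is recovered as the sum of the two nonzero coordinates.
\<close>

lemma quartic_permute:
  "quartic x 0 y = quartic x y 0" "quartic 0 x y = quartic x y 0"
  by (simp_all add: quartic_def)

lemma quartic_eq_square_iff:
  "quartic x y 0 = of_int (k\<^sup>2) \<longleftrightarrow> x\<^sup>2 - y\<^sup>2 = of_int k \<or> y\<^sup>2 - x\<^sup>2 = of_int k"
proof -
  have "quartic x y 0 = (x\<^sup>2 - y\<^sup>2)\<^sup>2"
    by (simp add: quartic_def power4_eq_xxxx power2_eq_square algebra_simps)
  then have "quartic x y 0 = of_int (k\<^sup>2) \<longleftrightarrow> x\<^sup>2 - y\<^sup>2 = of_int k \<or> x\<^sup>2 - y\<^sup>2 = - of_int k"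
    by (simp add: power2_eq_iff)
  then show ?thesis by auto
qed

lemma e_val_pos:
  assumes "admissible k k1 k2 m1 m2"
  shows "e_val k1 k2 m1 m2 > 0"
  using assms unfolding admissible_def e_val_def by (auto intro!: add_pos_pos)

text \<open>The condition \<open>k1 * m1\<^sup>2 \<noteq> k2 * m2\<^sup>2\<close> says exactly that the two numbers whose
  difference is taken are distinct.\<close>

lemma f_val_pos:
  assumes "admissible k k1 k2 m1 m2"
  shows "f_val k1 k2 m1 m2 > 0"
proof -
  have pos: "m1 > 0" "m2 > 0" and ne: "k1 * m1\<^sup>2 \<noteq> k2 * m2\<^sup>2"
    using assms unfolding admissible_def by auto
  have "rat_of_int (k1 * m1\<^sup>2) \<noteq> of_int (k2 * m2\<^sup>2)"
    using ne of_int_eq_iff by blast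
  then have "(of_int k1 * of_int m1 / of_int m2 :: rat) \<noteq> of_int k2 * of_int m2 / of_int m1"
    using pos by (simp add: frac_eq_eq power2_eq_square mult_ac)
  then show ?thesis
    unfolding f_val_def by simp
qed

lemma e_val_f_val_on_hyperbola:
  assumes "admissible k k1 k2 m1 m2"
  shows "(e_val k1 k2 m1 m2)\<^sup>2 - (f_val k1 k2 m1 m2)\<^sup>2 = of_int k"
proof -
  define p q :: rat
    where "p = of_int k1 * of_int m1 / of_int m2" and "q = of_int k2 * of_int m2 / of_int m1"
  have "(e_val k1 k2 m1 m2)\<^sup>2 - (f_val k1 k2 m1 m2)\<^sup>2 = p * q"
    unfolding e_val_def f_val_def p_def[symmetric] q_def[symmetric]
    by (simp add: power2_eq_square field_simps)
  also have "\<dots> = of_int k1 * of_int k2"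
    using assms unfolding p_def q_def admissible_def by simp
  also have "\<dots> = of_int k"
    using assms unfolding admissible_def by (metis of_int_mult)
  finally show ?thesis .
qed

text \<open>The positive branch: \<open>u + v\<close> and \<open>u - v\<close> are positive with product \<open>k\<close>, and the
  numerator and denominator of \<open>u + v\<close> serve as \<open>m1\<close> and \<open>m2\<close>.\<close>

lemma hyperbola_point_parametrised:
  fixes u v :: rat
  assumes "k > 0" and hyp: "u\<^sup>2 - v\<^sup>2 = of_int k" and "u \<ge> 0" and "v > 0"
  obtains m1 m2 where "admissible k 1 k m1 m2" "u = e_val 1 k m1 m2" "v = f_val 1 k m1 m2"
proof -
  obtain m1 m2 where quot: "quotient_of (u + v) = (m1, m2)"
    by (cases "quotient_of (u + v)")
  have p: "u + v = of_int m1 / of_int m2" and m2: "m2 > 0" and cop: "coprime m1 m2"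
    using quotient_of_div[OF quot] quotient_of_denom_pos[OF quot] quotient_of_coprime[OF quot]
    by auto
  have "u + v > 0"
    using \<open>u \<ge> 0\<close> \<open>v > 0\<close> by simp
  then have m1: "m1 > 0"
    using p m2 by (simp add: zero_less_divide_iff)
  have "(u + v) * (u - v) = of_int k"
    using hyp by (simp add: power2_eq_square algebra_simps)
  then have "u - v = of_int k / (u + v)"
    using \<open>u + v > 0\<close> by (simp add: field_simps)
  then have q: "u - v = of_int k * of_int m2 / of_int m1"
    unfolding p by simp
  have "m1\<^sup>2 \<noteq> k * m2\<^sup>2"
  proof
    assume "m1\<^sup>2 = k * m2\<^sup>2"
    then have "rat_of_int (m1\<^sup>2) = of_int (k * m2\<^sup>2)"
      by simp
    then have "of_int m1 / of_int m2 = (of_int k * of_int m2 / of_int m1 :: rat)"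
      using m1 m2 by (simp add: frac_eq_eq power2_eq_square mult_ac)
    then show False
      using p q \<open>v > 0\<close> by simp
  qed
  then have "admissible k 1 k m1 m2"
    using m1 m2 cop \<open>k > 0\<close> unfolding admissible_def by simp
  moreover have "u = e_val 1 k m1 m2"
    using p q unfolding e_val_def by simp
  moreover have "v = f_val 1 k m1 m2"
    using p[symmetric] q[symmetric] \<open>v > 0\<close> unfolding f_val_def by simp
  ultimately show thesis
    by (rule that)
qed

lemma eq_sign_mult_abs:
  fixes x :: "'a::linordered_idom"
  obtains s where "s \<in> {1, -1}" "x = s * \<bar>x\<bar>"
proof (cases "x \<ge> 0")
  case True
  with that[of 1] show thesis by simp
next
  case False
  with that[of "-1"] show thesis by simp
qed

lemma signed_pairs_eq_hyperbola:
  assumes "k > 0"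
  shows "signed_pairs k = {(u, v). u\<^sup>2 - v\<^sup>2 = of_int k \<and> v \<noteq> 0}"
proof (intro equalityI subsetI)
  fix w assume "w \<in> signed_pairs k"
  then obtain s t :: rat and k1 k2 m1 m2
    where w: "w = (s * e_val k1 k2 m1 m2, t * f_val k1 k2 m1 m2)"
      and st: "s \<in> {1, -1}" "t \<in> {1, -1}" and adm: "admissible k k1 k2 m1 m2"
    unfolding signed_pairs_def by blast
  show "w \<in> {(u, v). u\<^sup>2 - v\<^sup>2 = of_int k \<and> v \<noteq> 0}"
    using st e_val_f_val_on_hyperbola[OF adm] f_val_pos[OF adm]
    unfolding w by (auto simp: power_mult_distrib)
next
  fix w :: "rat \<times> rat" assume "w \<in> {(u, v). u\<^sup>2 - v\<^sup>2 = of_int k \<and> v \<noteq> 0}"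
  then obtain u v where w: "w = (u, v)" and hyp: "u\<^sup>2 - v\<^sup>2 = of_int k" and "v \<noteq> 0"
    by blast
  obtain m1 m2 where adm: "admissible k 1 k m1 m2"
    and e: "\<bar>u\<bar> = e_val 1 k m1 m2" and f: "\<bar>v\<bar> = f_val 1 k m1 m2"
    using hyperbola_point_parametrised[OF \<open>k > 0\<close>, of "\<bar>u\<bar>" "\<bar>v\<bar>"] hyp \<open>v \<noteq> 0\<close> by auto
  obtain s where s: "s \<in> {1, -1}" "u = s * e_val 1 k m1 m2"
    using eq_sign_mult_abs[of u] unfolding e by blast
  obtain t where t: "t \<in> {1, -1}" "v = t * f_val 1 k m1 m2"
    using eq_sign_mult_abs[of v] unfolding f by blast
  show "w \<in> signed_pairs k"
    unfolding w signed_pairs_def using s t adm by blast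
qed

lemma solutions_eq_classes:
  assumes "k > 0"
  shows "solutions (k\<^sup>2) = C1 k \<union> C2 k \<union> C3 k \<union> C4 k \<union> C5 k \<union> C6 k"
proof -
  \<comment> \<open>On the hyperbola \<open>u\<close> never vanishes because \<open>k > 0\<close>, so a point of a class has exactly
    one zero coordinate.\<close>
  have nz: "u \<noteq> 0" if "u\<^sup>2 - v\<^sup>2 = of_int k" for u v :: rat
  proof
    assume "u = 0"
    then have "- v\<^sup>2 = of_int k" using that by simp
    moreover have "rat_of_int k > 0" using assms by simp
    ultimately show False using zero_le_power2[of v] by linarith
  qed
  have "(a, b, c) \<in> solutions (k\<^sup>2) \<longleftrightarrow>
        (a, b, c) \<in> C1 k \<union> C2 k \<union> C3 k \<union> C4 k \<union> C5 k \<union> C6 k" for a b c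
    unfolding solutions_def exactly_one_zero_def C1_def C2_def C3_def C4_def C5_def C6_def
      signed_pairs_eq_hyperbola[OF assms]
    using nz[of a b] nz[of b a] nz[of a c] nz[of c a] nz[of b c] nz[of c b]
    by (auto simp: quartic_permute quartic_eq_square_iff simp del: of_int_power)
  then show ?thesis by auto
qed

lemma infinite_solutions:
  assumes "k > 0"
  shows "infinite (solutions (k\<^sup>2))"
proof
  assume fin: "finite (solutions (k\<^sup>2))"
  define pt :: "int \<Rightarrow> rat \<times> rat \<times> rat"
    where "pt p = ((of_int p + of_int k / of_int p) / 2, (of_int p - of_int k / of_int p) / 2, 0)"
    for p
  have "inj pt"
  proof (rule injI)
    fix p q assume eq: "pt p = pt q"
    have "fst (pt r) + fst (snd (pt r)) = of_int r" for r
      unfolding pt_def by (simp add: field_simps)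
    then show "p = q"
      using eq by (metis of_int_eq_iff)
  qed
  moreover have "pt ` {k<..} \<subseteq> solutions (k\<^sup>2)"
  proof (intro subsetI, elim imageE)
    fix w p assume w: "w = pt p" and "p \<in> {k<..}"
    then have p: "p > k" "p > 0" using assms by auto
    define x y :: rat
      where "x = (of_int p + of_int k / of_int p) / 2"
        and "y = (of_int p - of_int k / of_int p) / 2"
    have "x\<^sup>2 - y\<^sup>2 = of_int p * (of_int k / of_int p)"
      unfolding x_def y_def by (simp add: power2_eq_square field_simps)
    then have "quartic x y 0 = of_int (k\<^sup>2)"
      using p by (simp add: quartic_eq_square_iff del: of_int_power)
    moreover have "x > 0"
      unfolding x_def using p assms by (simp add: add_pos_pos)
    moreover have "y > 0"
    proof -
      have "k * 1 < p * p" using p assms by (intro mult_strict_mono) auto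
      then have "rat_of_int k < of_int p * of_int p"
        by (metis mult.right_neutral of_int_less_iff of_int_mult)
      then show ?thesis unfolding y_def using p by (simp add: pos_divide_less_eq)
    qed
    ultimately show "w \<in> solutions (k\<^sup>2)"
      unfolding w pt_def x_def[symmetric] y_def[symmetric] solutions_def exactly_one_zero_def
      by auto
  qed
  ultimately have "finite {k<..}"
    using fin by (metis finite_imageD finite_subset inj_on_subset subset_UNIV)
  then show False
    by (simp add: infinite_Ioi)
qed

theorem theorem9:
  fixes n k :: int
  assumes "k \<ge> 2" and "n = k^2"
  shows "infinite (solutions n)
    \<and> solutions n = C1 k \<union> C2 k \<union> C3 k \<union> C4 k \<union> C5 k \<union> C6 k
    \<and> (\<forall>k1 k2 m1 m2. admissible k k1 k2 m1 m2 \<longrightarrow>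
          e_val k1 k2 m1 m2 > 0 \<and> f_val k1 k2 m1 m2 > 0)"
proof -
  have "k > 0" using \<open>k \<ge> 2\<close> by simp
  then show ?thesis
    unfolding \<open>n = k^2\<close>
    using infinite_solutions solutions_eq_classes e_val_pos f_val_pos by blast
qed

end
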